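(* Let $K>1$ and let $(z_j)_{j\in\mathbb{N}}$ be an infinite sequence of points in $\mathbb{C}$ with $|z_j|\to\infty$ satisfying $|z_j|<|z_{j+1}|\le K|z_j|$ for all $j$. Let $\mathcal{O}$ be the Riemann orbifold whose underlying surface is $\mathbb{C}$ and whose ramified points are exactly the points $z_j$, each with ramification value $2$. Then the density $\rho_{\mathcal{O}}$ of the hyperbolic metric on $\mathcal{O}$ is bounded below by a constant multiple of $1/|z|$ near infinity: there exist constants $c>0$ and $R>0$ such that $$\rho_{\mathcal{O}}(z)\ge \frac{c}{|z|}\qquad\text{for all } z \text{ with } |z|\ge R.$$
   Context: A Riemann orbifold is a pair $(S,\nu)$ with $S$ a Riemann surface and $\nu:S\to\mathbb{N}_{\ge1}$ (the ramification map) such that $\{z\in S:\nu(z)>1\}$ (the set of ramified points) is a discrete subset of $S$, i.e. has no accumulation point in $S$. A holomorphic map $f:\widetilde S\to S$ is a branched covering if every point of $S$ has a connected neighbourhood $U$ such that $f$ maps every component of $f^{-1}(U)$ onto $U$ as a proper map. An orbifold covering $(\widetilde S,\tilde\nu)\to(S,\nu)$ is a branched covering $f:\widetilde S\to S$ with $\nu(f(z))=\deg(f,z)\,\tilde\nu(z)$ for all $z\in\widetilde S$, where $\deg(f,z)$ is the local degree. An orbifold is hyperbolic if it admits an orbifold covering by the unit disk $\mathbb{D}$ (with trivial ramification map). Its hyperbolic metric $\rho_{\mathcal{O}}(w)|dw|$ is the push-forward of the complete conformal metric of constant curvature $-1$ on $\mathbb{D}$ under such a covering $\pi$, i.e. $\rho_{\mathcal{O}}(\pi(z))\,|\pi'(z)|=\rho_{\mathbb{D}}(z)$;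 $\rho_{\mathcal{O}}=+\infty$ at ramified points. The orbifold $\mathcal{O}$ of the statement is hyperbolic. *)

theory Defs
  imports "HOL-Complex_Analysis.Complex_Analysis"
begin

text \<open>
  Underlying surfaces are planar domains: the library has no abstract Riemann surfaces, and only
  the complex plane and the unit disk are needed. The ramification map is a total function of
  which only the values on the surface matter.
\<close>

definition riemann_orbifold :: "complex set \<Rightarrow> (complex \<Rightarrow> nat) \<Rightarrow> bool" where
  "riemann_orbifold S \<nu> \<longleftrightarrow>
     open S \<and> connected S \<and> S \<noteq> {} \<and>
     (\<forall>z\<in>S. \<nu> z \<ge> 1) \<and>
     (\<forall>z\<in>S. \<not> z islimpt {w\<in>S. \<nu> w > 1})"

definition branched_covering :: "complex set \<Rightarrow> complex set \<Rightarrow> (complex \<Rightarrow> complex) \<Rightarrow> bool" where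
  "branched_covering S' S f \<longleftrightarrow>
     f holomorphic_on S' \<and> f ` S' \<subseteq> S \<and>
     (\<forall>w\<in>S. \<exists>U. open U \<and> connected U \<and> w \<in> U \<and> U \<subseteq> S \<and>
        (\<forall>C\<in>components {z\<in>S'. f z \<in> U}.
           f ` C = U \<and> proper_map (top_of_set C) (top_of_set U) f))"

text \<open>
  A branched covering is nonconstant, so the order of vanishing below is a positive integer and
  \<^const>\<open>nat\<close> loses nothing.
\<close>

definition local_degree :: "(complex \<Rightarrow> complex) \<Rightarrow> complex \<Rightarrow> nat" where
  "local_degree f z = nat (zorder (\<lambda>w. f w - f z) z)"

definition orbifold_covering ::
  "complex set \<Rightarrow> (complex \<Rightarrow> nat) \<Rightarrow> complex set \<Rightarrow> (complex \<Rightarrow> nat) \<Rightarrow> (complex \<Rightarrow> complex) \<Rightarrow> bool"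
where
  "orbifold_covering S' \<nu>' S \<nu> f \<longleftrightarrow>
     riemann_orbifold S' \<nu>' \<and> riemann_orbifold S \<nu> \<and>
     branched_covering S' S f \<and>
     (\<forall>z\<in>S'. \<nu> (f z) = local_degree f z * \<nu>' z)"

abbreviation disk_covering :: "complex set \<Rightarrow> (complex \<Rightarrow> nat) \<Rightarrow> (complex \<Rightarrow> complex) \<Rightarrow> bool" where
  "disk_covering S \<nu> \<pi> \<equiv> orbifold_covering (ball 0 1) (\<lambda>_. 1) S \<nu> \<pi>"

definition hyperbolic_orbifold :: "complex set \<Rightarrow> (complex \<Rightarrow> nat) \<Rightarrow> bool" where
  "hyperbolic_orbifold S \<nu> \<longleftrightarrow> (\<exists>\<pi>. disk_covering S \<nu> \<pi>)"

text \<open>The Poincare density, normalised so that the Gaussian curvature is \<open>-1\<close>.\<close>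

definition disk_density :: "complex \<Rightarrow> real" where
  "disk_density z = 2 / (1 - (norm z)\<^sup>2)"

text \<open>
  \<open>\<rho>\<close> is the density of the push-forward of the disk metric under a disk covering. The defining
  equation is imposed at unramified points only: over a ramified point the derivative of the
  covering vanishes, and \<open>\<infinity> * 0 = 0\<close> in \<^typ>\<open>ereal\<close>. The push-forward does not depend on the
  covering, so one covering is enough to determine \<open>\<rho>\<close> on \<open>S\<close>.
\<close>

definition hyperbolic_density ::
  "complex set \<Rightarrow> (complex \<Rightarrow> nat) \<Rightarrow> (complex \<Rightarrow> ereal) \<Rightarrow> bool" where
  "hyperbolic_density S \<nu> \<rho> \<longleftrightarrow>
     (\<exists>\<pi>. disk_covering S \<nu> \<pi> \<and>
        (\<forall>z\<in>ball 0 1. \<nu> (\<pi> z) = 1 \<longrightarrow>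
           \<rho> (\<pi> z) * ereal (norm (deriv \<pi> z)) = ereal (disk_density z))) \<and>
     (\<forall>w\<in>S. \<nu> w > 1 \<longrightarrow> \<rho> w = \<infinity>)"

end

theory Submission
  imports Defs
begin

text \<open>
  Fix a disk covering \<open>\<pi>\<close>, a point \<open>\<zeta>\<close> with \<open>w = \<pi> \<zeta>\<close> large, and rescale \<open>\<pi>\<close> on a disk about \<open>\<zeta>\<close>
  to a function \<open>f\<close> on the unit disk, divided by \<open>w\<close>. Let \<open>z\<^sub>l\<close> be the first ramified point with
  modulus above \<open>2 |w|\<close>. Then \<open>f\<close> takes the values \<open>a\<^sub>1 = z\<^sub>1 / w\<close>, \<open>a\<^sub>2 = z\<^sub>0 / w\<close> and
  \<open>a\<^sub>3 = z\<^sub>l / w\<close> with even multiplicity only, these are bounded by \<open>2 K\<close>, and \<open>|a\<^sub>3 - a\<^sub>2| \<ge> 1\<close>;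
  how close \<open>a\<^sub>1\<close> and \<open>a\<^sub>2\<close> are does not matter. A bound for \<open>f'(0)\<close> depending on \<open>K\<close> alone is
  the claim.

  Write \<open>f - a\<^sub>i = g\<^sub>i\<^sup>2\<close>. Since \<open>(g\<^sub>1 + g\<^sub>2) (g\<^sub>1 - g\<^sub>2) = a\<^sub>2 - a\<^sub>1\<close>, the function \<open>h = g\<^sub>1 + g\<^sub>2\<close> has no
  zeros, and \<open>(2 h g\<^sub>3)\<^sup>2 = (h - p) (h - q) (h + p) (h + q)\<close> with \<open>p, q\<close> determined by
  \<open>p + q = 2 \<surd>(a\<^sub>3 - a\<^sub>1)\<close> and \<open>p - q = 2 \<surd>(a\<^sub>3 - a\<^sub>2)\<close>. The four factors have no common zeros, so
  \<open>h - p = k\<^sup>2\<close> and \<open>h - q = l\<^sup>2\<close>. Repeating the argument, \<open>k + l\<close> omits \<open>0\<close>, and also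
  \<open>\<i> (\<surd>p + \<surd>q)\<close> because \<open>h\<close> omits \<open>0\<close>. Schottky's theorem bounds \<open>k + l\<close>; flipping the signs of
  \<open>l\<close> and then of \<open>g\<^sub>2\<close> bounds \<open>k\<close>, \<open>h\<close>, \<open>g\<^sub>1\<close> and \<open>f\<close> in turn, and Cauchy's inequality bounds \<open>f'(0)\<close>.
\<close>

section \<open>Holomorphic square roots from even zeros\<close>

text \<open>Dividing \<open>f\<close> by the square of a polynomial \<open>P\<close> that carries
  half of each zero leaves a zero-free function, which has a square root because \<open>S\<close> is
  contractible. Finiteness of the zero set makes \<open>P\<close> a finite product and rules out
  \<open>f\<close> vanishing identically.\<close>

lemma even_zeros_imp_square:
  fixes f :: "complex \<Rightarrow> complex"
  assumes f: "f holomorphic_on S" and S: "open S" "contractible S"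
    and fin: "finite {z\<in>S. f z = 0}"
    and even_order: "\<And>z. z \<in> S \<Longrightarrow> f z = 0 \<Longrightarrow> even (zorder f z)"
  obtains g where "g holomorphic_on S" "\<And>z. z \<in> S \<Longrightarrow> f z = (g z)\<^sup>2"
proof -
  define Z where "Z = {z\<in>S. f z = 0}"
  define m where "m w = nat (zorder f w) div 2" for w
  define P where "P z = (\<Prod>w\<in>Z. (z - w) ^ m w)" for z
  have conn: "connected S"
    using S by (simp add: contractible_imp_connected)
  have finZ: "finite Z"
    using fin by (simp add: Z_def)
  have P_hol: "P holomorphic_on A" for A
    unfolding P_def by (intro holomorphic_intros)
  have nonzero: "\<exists>w\<in>S. f w \<noteq> 0" if "a \<in> S" for a
  proof (rule ccontr)
    assume "\<not> ?thesis"
    then have "Z = S" by (auto simp: Z_def)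
    with finZ that S(1) show False
      using finite_imp_not_open by auto
  qed
  have two_m: "int (2 * m a) = zorder f a" and m_pos: "m a > 0" if "a \<in> Z" for a
  proof -
    have a: "a \<in> S" "f a = 0" using that by (auto simp: Z_def)
    have "zorder f a > 0"
      using zorder_exist_zero[OF f S(1) conn a(1) nonzero[OF a(1)]] a(2) by auto
    moreover have "even (zorder f a)"
      using even_order a by blast
    ultimately obtain n where "zorder f a = int (2 * n)" "n > 0"
      using zero_less_imp_eq_int by fastforce
    then show "int (2 * m a) = zorder f a" "m a > 0"
      by (simp_all add: m_def)
  qed
  have P_zero: "P z = 0 \<longleftrightarrow> f z = 0" if "z \<in> S" for z
    using that m_pos finZ by (auto simp: P_def Z_def)
  have order: "zorder (\<lambda>z. (P z)\<^sup>2) a = zorder f a" if a: "a \<in> S" for a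
  proof (cases "a \<in> Z")
    case True
    define Q where "Q z = (\<Prod>w\<in>Z - {a}. (z - w) ^ m w)" for z
    have PQ: "P z = (z - a) ^ m a * Q z" for z
      unfolding P_def Q_def using True finZ by (subst prod.remove[of _ a]) auto
    show ?thesis
    proof (rule zorder_eqI[of UNIV])
      show "(\<lambda>z. (Q z)\<^sup>2) holomorphic_on UNIV"
        unfolding Q_def by (intro holomorphic_intros)
      show "(Q a)\<^sup>2 \<noteq> 0"
        using finZ by (auto simp: Q_def)
      fix w assume "w \<noteq> a"
      show "(P w)\<^sup>2 = (Q w)\<^sup>2 * (w - a) powi zorder f a"
        by (simp only: two_m[OF True, symmetric] power_int_of_nat)
          (simp add: PQ power_mult_distrib power_mult power2_eq_square mult_ac)
    qed auto
  next
    case False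
    then have fa: "f a \<noteq> 0" "P a \<noteq> 0"
      using a P_zero by (auto simp: Z_def)
    have "f analytic_on {a}"
      using f S(1) a analytic_at by blast
    moreover have "(\<lambda>z. (P z)\<^sup>2) analytic_on {a}"
      unfolding analytic_at by (rule exI[of _ UNIV]) (auto intro!: holomorphic_intros P_hol)
    ultimately show ?thesis
      using fa by (simp add: zorder_eq_0I)
  qed
  have P2_hol: "(\<lambda>z. (P z)\<^sup>2) holomorphic_on S"
    by (intro holomorphic_intros P_hol)
  have zeros: "(P z)\<^sup>2 = 0 \<longleftrightarrow> f z = 0" if "z \<in> S" for z
    using P_zero[OF that] by simp
  obtain h where h: "h holomorphic_on S" "\<And>z. z \<in> S \<Longrightarrow> h z \<noteq> 0"
      "\<And>z. z \<in> S \<Longrightarrow> f z = h z * (P z)\<^sup>2"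
    using holomorphic_zorder_factorization[OF f S(1) conn P2_hol zeros order] by blast
  obtain k where k: "k holomorphic_on S" "\<And>z. z \<in> S \<Longrightarrow> h z = (k z)\<^sup>2"
    using contractible_imp_holomorphic_sqrt[OF h(1) S(2) h(2)] by metis
  show thesis
  proof
    show "(\<lambda>z. k z * P z) holomorphic_on S"
      by (intro holomorphic_intros k P_hol)
    show "f z = (k z * P z)\<^sup>2" if "z \<in> S" for z
      using h(3) k(2) that by (simp add: power_mult_distrib)
  qed
qed

text \<open>At a zero of \<open>f\<close> the cofactor \<open>g\<close> has order 0, so
  \<open>f\<close> has there the order of \<open>s\<close> squared, which is even.\<close>

lemma coprime_factor_of_square:
  fixes f :: "complex \<Rightarrow> complex"
  assumes f: "f holomorphic_on S" and g: "g holomorphic_on S" and s: "s holomorphic_on S"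
    and S: "open S" "contractible S"
    and fin: "finite {z\<in>S. f z = 0}"
    and eq: "\<And>z. z \<in> S \<Longrightarrow> f z * g z = (s z)\<^sup>2"
    and coprime: "\<And>z. z \<in> S \<Longrightarrow> f z = 0 \<Longrightarrow> g z \<noteq> 0"
  obtains k where "k holomorphic_on S" "\<And>z. z \<in> S \<Longrightarrow> f z = (k z)\<^sup>2"
proof (rule even_zeros_imp_square[OF f S fin])
  fix a assume a: "a \<in> S" "f a = 0"
  have ana: "f analytic_on {a}" "g analytic_on {a}" "s analytic_on {a}"
    using f g s S(1) a analytic_at by blast+
  have "\<not> a islimpt {z\<in>S. f z = 0}"
    using fin by (simp add: islimpt_finite)
  then have "\<forall>\<^sub>F z in at a. z \<notin> {z\<in>S. f z = 0}"
    by (simp add: islimpt_iff_eventually)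
  moreover have inS: "\<forall>\<^sub>F z in at a. z \<in> S"
    using a S(1) by (simp add: eventually_at_in_open')
  ultimately have f_nz: "\<forall>\<^sub>F z in at a. f z \<noteq> 0"
    by eventually_elim auto
  have "isCont g a"
    using ana(2) analytic_at_imp_isCont by blast
  then have "\<forall>\<^sub>F z in at a. g z \<noteq> 0"
    using coprime[OF a] by (simp add: isCont_def tendsto_imp_eventually_ne)
  \<comment> \<open>Additivity of \<open>zorder\<close> requires that no factor vanish identically
    near \<open>a\<close>.\<close>
  with f_nz inS have ev: "\<forall>\<^sub>F z in at a. z \<in> S \<and> f z \<noteq> 0 \<and> g z \<noteq> 0 \<and> s z \<noteq> 0"
    by eventually_elim (use eq in force)
  then have freq: "\<exists>\<^sub>F z in at a. f z \<noteq> 0" "\<exists>\<^sub>F z in at a. g z \<noteq> 0" "\<exists>\<^sub>F z in at a. s z \<noteq> 0"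
    by (auto intro!: eventually_frequently elim: eventually_mono)
  have "zorder (\<lambda>z. f z * g z) a = zorder f a + zorder g a"
    using ana freq by (intro zorder_mult analytic_on_imp_meromorphic_on)
  moreover have "zorder g a = 0"
    using ana(2) coprime[OF a] by (rule zorder_eq_0I)
  moreover have "zorder (\<lambda>z. f z * g z) a = zorder (\<lambda>z. (s z)\<^sup>2) a"
    by (rule zorder_cong[OF eventually_mono[OF inS] refl]) (use eq in auto)
  moreover have "zorder (\<lambda>z. (s z)\<^sup>2) a = int 2 * zorder s a"
    using zorder_power[OF analytic_on_imp_meromorphic_on[OF ana(3)] freq(3), of 2] by simp
  ultimately have "zorder f a = 2 * zorder s a"
    by linarith
  then show "even (zorder f a)"
    by simp
qed (use that in blast)

section \<open>Bounds from Schottky's theorem\<close>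

text \<open>Division by \<open>e\<close> normalises the omitted values to 0 and 1, and halving the
  argument gives holomorphy on the closed unit disk. The radius 1/4 becomes 1/2, so the exponent is
  2 + 2 r + 12, that is, 14 + 2 r.\<close>

lemma Schottky_two_omitted_values:
  assumes v: "v holomorphic_on ball 0 1"
    and omits: "\<And>z. z \<in> ball 0 1 \<Longrightarrow> v z \<noteq> 0 \<and> v z \<noteq> e"
    and v0: "norm (v 0) \<le> r * norm e" and e: "e \<noteq> 0" and z: "norm z \<le> 1 / 4"
  shows "norm (v z) \<le> norm e * exp (pi * exp (pi * (14 + 2 * r)))"
proof -
  define V where "V u = v (u / 2) / e" for u
  have "norm (V (2 * z)) \<le> exp (pi * exp (pi * (2 + 2 * r + 12 * (1 / 2) / (1 - 1 / 2))))"
  proof (rule Schottky[where f = V and z = "2 * z"])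
    have "(\<lambda>u. u / 2) ` cball 0 1 \<subseteq> ball (0 :: complex) 1"
      by (auto simp: norm_divide)
    then have "(v \<circ> (\<lambda>u. u / 2)) holomorphic_on cball 0 1"
      by (intro holomorphic_on_compose_gen[OF _ v] holomorphic_intros) auto
    then show "V holomorphic_on cball 0 1"
      unfolding V_def comp_def using e by (intro holomorphic_intros)
    show "norm (V 0) \<le> r"
      using v0 e by (simp add: V_def norm_divide divide_le_eq)
    show "\<not> (V u = 0 \<or> V u = 1)" if "u \<in> cball 0 1" for u
      using omits[of "u / 2"] that e by (auto simp: V_def norm_divide)
    show "norm (2 * z) \<le> 1 / 2"
      using z by (simp add: norm_mult)
  qed auto
  then have "norm (v z) / norm e \<le> exp (pi * exp (pi * (14 + 2 * r)))"
    by (simp add: V_def norm_divide algebra_simps)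
  then show ?thesis
    using e by (simp add: divide_le_eq mult.commute)
qed

lemma norm_le_sqrt:
  fixes x :: complex
  assumes "norm (x\<^sup>2) \<le> y"
  shows "norm x \<le> sqrt y"
  using assms by (simp add: norm_power real_le_rsqrt)

text \<open>
  If \<open>v\<close> were equal to \<open>\<i> (\<alpha> + \<beta>)\<close> with \<open>\<alpha>\<^sup>2 = p\<close> and \<open>\<beta>\<^sup>2 = q\<close>, then
  \<open>k - l = (q - p) / v = \<i> (\<alpha> - \<beta>)\<close>, so \<open>k = \<i> \<alpha>\<close> and \<open>k\<^sup>2 + p\<close> would vanish.
\<close>
lemma sum_of_roots_bound:
  assumes k: "k holomorphic_on ball 0 1" and l: "l holomorphic_on ball 0 1"
    and eq: "\<And>z. z \<in> ball 0 1 \<Longrightarrow> (k z)\<^sup>2 + p = (l z)\<^sup>2 + q"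
    and nz: "\<And>z. z \<in> ball 0 1 \<Longrightarrow> (k z)\<^sup>2 + p \<noteq> 0"
    and pq: "norm p \<le> N" "norm q \<le> N" "norm (p - q) \<ge> 1"
    and k0: "norm ((k 0)\<^sup>2 + p) \<le> N" and z: "norm z \<le> 1 / 4"
  shows "norm (k z + l z) \<le>
    2 * sqrt N * exp (pi * exp (pi * (14 + 2 * (2 * sqrt (2 * N)))))"
proof -
  define v where "v u = k u + l u" for u
  define \<alpha> where "\<alpha> = csqrt p"
  \<comment> \<open>The sign of \<open>\<beta>\<close> keeps the omitted value \<open>e\<close> away from \<open>0\<close>: \<open>|e|\<^sup>2 \<ge> |p - q|\<close>.\<close>
  define \<beta> where "\<beta> = (if norm (\<alpha> + csqrt q) \<ge> norm (\<alpha> - csqrt q) then csqrt q else - csqrt q)"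
  define e where "e = \<i> * (\<alpha> + \<beta>)"
  have sq: "\<alpha>\<^sup>2 = p" "\<beta>\<^sup>2 = q"
    by (auto simp: \<alpha>_def \<beta>_def)
  have "norm (\<alpha> - \<beta>) \<le> norm (\<alpha> + \<beta>)"
    by (auto simp: \<beta>_def)
  then have "norm (\<alpha> - \<beta>) * norm (\<alpha> + \<beta>) \<le> (norm (\<alpha> + \<beta>))\<^sup>2"
    by (simp add: power2_eq_square mult_right_mono)
  moreover have "norm (\<alpha> - \<beta>) * norm (\<alpha> + \<beta>) = norm (p - q)"
    unfolding norm_mult[symmetric] sq[symmetric] by (simp add: power2_eq_square algebra_simps)
  ultimately have "1\<^sup>2 \<le> (norm (\<alpha> + \<beta>))\<^sup>2"
    using pq(3) by simp
  then have "1 \<le> norm (\<alpha> + \<beta>)"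
    by (rule power2_le_imp_le) simp
  then have e_ge: "norm e \<ge> 1"
    by (simp add: e_def norm_mult)
  have "norm \<alpha> \<le> sqrt N" "norm \<beta> \<le> sqrt N"
    using pq sq by (auto intro!: norm_le_sqrt)
  then have e_le: "norm e \<le> 2 * sqrt N"
    unfolding e_def norm_mult using norm_triangle_ineq[of \<alpha> \<beta>] by simp
  have prod: "v u * (k u - l u) = q - p" if "u \<in> ball 0 1" for u
    using eq[OF that] by (simp add: v_def algebra_simps power2_eq_square)
  have "p \<noteq> q" using pq(3) by auto
  have omits: "v u \<noteq> 0 \<and> v u \<noteq> e" if u: "u \<in> ball 0 1" for u
  proof
    show "v u \<noteq> 0"
      using prod[OF u] \<open>p \<noteq> q\<close> by auto
    show "v u \<noteq> e"
    proof
      assume ve: "v u = e"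
      have "e \<noteq> 0" using e_ge by auto
      have "e * (\<i> * (\<alpha> - \<beta>)) = q - p"
        unfolding sq[symmetric] by (simp add: e_def power2_eq_square algebra_simps)
      then have "e * (k u - l u) = e * (\<i> * (\<alpha> - \<beta>))"
        using prod[OF u] ve by simp
      with \<open>e \<noteq> 0\<close> have "k u - l u = \<i> * (\<alpha> - \<beta>)"
        by simp
      with ve have "2 * k u = 2 * (\<i> * \<alpha>)"
        unfolding v_def e_def by algebra
      then have "k u = \<i> * \<alpha>" by simp
      then have "(k u)\<^sup>2 + p = 0"
        by (simp add: power_mult_distrib sq)
      with nz[OF u] show False by simp
    qed
  qed
  have "norm (k 0) \<le> sqrt (2 * N)"
    using k0 pq(1) norm_triangle_ineq4[of "(k 0)\<^sup>2 + p" p] by (intro norm_le_sqrt) simp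
  moreover have "norm (l 0) \<le> sqrt (2 * N)"
    using k0 pq(2) norm_triangle_ineq4[of "(l 0)\<^sup>2 + q" q] eq[of 0] by (intro norm_le_sqrt) simp
  ultimately have v0: "norm (v 0) \<le> 2 * sqrt (2 * N)"
    unfolding v_def using norm_triangle_ineq[of "k 0" "l 0"] by simp
  \<comment> \<open>As \<open>e\<close> has modulus at least 1, the ratio \<open>r\<close> can be
    chosen independently of \<open>e\<close>.\<close>
  then have "norm (v 0) \<le> 2 * sqrt (2 * N) * norm e"
    using mult_left_mono[OF e_ge, of "2 * sqrt (2 * N)"] norm_ge_zero[of "v 0"] by linarith
  then have "norm (v z) \<le> norm e * exp (pi * exp (pi * (14 + 2 * (2 * sqrt (2 * N)))))"
    by (intro Schottky_two_omitted_values omits z)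
      (use e_ge in \<open>auto simp: v_def intro!: holomorphic_intros k l\<close>)
  also have "\<dots> \<le> 2 * sqrt N * exp (pi * exp (pi * (14 + 2 * (2 * sqrt (2 * N)))))"
    using e_le by (intro mult_right_mono) auto
  finally show ?thesis
    by (simp add: v_def)
qed

text \<open>Both \<open>l\<close> and \<open>- l\<close> are square roots of \<open>h - q\<close>,
  so \<open>k + l\<close> and \<open>k - l\<close> obey the same bound. Hence so does
  \<open>k\<close>, and \<open>h\<close> is \<open>k\<close> squared plus \<open>p\<close>.\<close>

lemma omitted_zero_two_even_values_bound:
  fixes N :: real
  obtains B where "\<And>h k l p q z. \<lbrakk>k holomorphic_on ball 0 1; l holomorphic_on ball 0 1;
      \<And>z. z \<in> ball 0 1 \<Longrightarrow> h z - p = (k z)\<^sup>2; \<And>z. z \<in> ball 0 1 \<Longrightarrow> h z - q = (l z)\<^sup>2;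
      \<And>z. z \<in> ball 0 1 \<Longrightarrow> h z \<noteq> 0; norm p \<le> N; norm q \<le> N; norm (p - q) \<ge> 1;
      norm (h 0) \<le> N; norm z \<le> 1 / 4\<rbrakk> \<Longrightarrow> norm (h z) \<le> B"
proof
  fix h k l :: "complex \<Rightarrow> complex" and p q z :: complex
  assume k: "k holomorphic_on ball 0 1" and l: "l holomorphic_on ball 0 1"
    and hp: "\<And>z. z \<in> ball 0 1 \<Longrightarrow> h z - p = (k z)\<^sup>2"
    and hq: "\<And>z. z \<in> ball 0 1 \<Longrightarrow> h z - q = (l z)\<^sup>2"
    and nz: "\<And>z. z \<in> ball 0 1 \<Longrightarrow> h z \<noteq> 0"
    and bounds: "norm p \<le> N" "norm q \<le> N" "norm (p - q) \<ge> 1" "norm (h 0) \<le> N"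
    and z: "norm z \<le> 1 / 4"
  define D where "D = 2 * sqrt N * exp (pi * exp (pi * (14 + 2 * (2 * sqrt (2 * N)))))"
  have kp: "(k u)\<^sup>2 + p = h u" and lq: "(l u)\<^sup>2 + q = h u" if "u \<in> ball 0 1" for u
    using hp[OF that] hq[OF that] by (simp_all add: algebra_simps)
  have "norm (k z + l z) \<le> D"
    unfolding D_def
    by (rule sum_of_roots_bound[OF k l _ _ bounds(1-3) _ z]) (use kp lq nz bounds in auto)
  moreover have "norm (k z + - l z) \<le> D"
    unfolding D_def
    by (rule sum_of_roots_bound[OF k holomorphic_on_minus[OF l] _ _ bounds(1-3) _ z])
      (use kp lq nz bounds in auto)
  ultimately have "norm (2 * k z) \<le> 2 * D"
    using norm_triangle_ineq[of "k z + l z" "k z + - l z"] by simp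
  then have "norm (k z) \<le> D"
    by (simp add: norm_mult)
  then have "norm ((k z)\<^sup>2) \<le> D\<^sup>2"
    by (simp add: norm_power power_mono)
  then have "norm ((k z)\<^sup>2 + p) \<le> D\<^sup>2 + N"
    using norm_triangle_ineq[of "(k z)\<^sup>2" p] bounds(1) by linarith
  then show "norm (h z) \<le> (2 * sqrt N * exp (pi * exp (pi * (14 + 2 * (2 * sqrt (2 * N))))))\<^sup>2 + N"
    using kp[of z] z by (simp add: D_def)
qed

section \<open>Functions taking three values with even multiplicity\<close>

lemma three_even_values_sum_bound:
  fixes M :: real
  obtains B where "\<And>f g1 g2 g3 a1 a2 a3 z. \<lbrakk>g1 holomorphic_on ball 0 1;
      g2 holomorphic_on ball 0 1; g3 holomorphic_on ball 0 1;
      \<And>z. z \<in> ball 0 1 \<Longrightarrow> f z - a1 = (g1 z)\<^sup>2; \<And>z. z \<in> ball 0 1 \<Longrightarrow> f z - a2 = (g2 z)\<^sup>2;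
      \<And>z. z \<in> ball 0 1 \<Longrightarrow> f z - a3 = (g3 z)\<^sup>2; finite {z\<in>ball 0 1. f z = a3};
      a1 \<noteq> a2; a1 \<noteq> a3; norm (a3 - a2) \<ge> 1;
      norm a1 \<le> M; norm a2 \<le> M; norm a3 \<le> M; norm (f 0) \<le> M; norm z \<le> 1 / 4\<rbrakk>
      \<Longrightarrow> norm (g1 z + g2 z) \<le> B"
proof -
  \<comment> \<open>Each of \<open>p\<close>, \<open>q\<close> and \<open>h 0\<close> is a sum or
    difference of two square roots of numbers of modulus at most 2 M.\<close>
  define N where "N = 2 * sqrt (2 * M)"
  obtain B where B: "\<And>h k l p q z. \<lbrakk>k holomorphic_on ball 0 1; l holomorphic_on ball 0 1;
      \<And>z. z \<in> ball 0 1 \<Longrightarrow> h z - p = (k z)\<^sup>2; \<And>z. z \<in> ball 0 1 \<Longrightarrow> h z - q = (l z)\<^sup>2;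
      \<And>z. z \<in> ball 0 1 \<Longrightarrow> h z \<noteq> 0; norm p \<le> N; norm q \<le> N; norm (p - q) \<ge> 1;
      norm (h 0) \<le> N; norm z \<le> 1 / 4\<rbrakk> \<Longrightarrow> norm (h z) \<le> B"
    using omitted_zero_two_even_values_bound[of N] by blast
  show thesis
  proof (rule that[of B])
    fix f g1 g2 g3 :: "complex \<Rightarrow> complex" and a1 a2 a3 z :: complex
    assume g: "g1 holomorphic_on ball 0 1" "g2 holomorphic_on ball 0 1" "g3 holomorphic_on ball 0 1"
      and f1: "\<And>z. z \<in> ball 0 1 \<Longrightarrow> f z - a1 = (g1 z)\<^sup>2"
      and f2: "\<And>z. z \<in> ball 0 1 \<Longrightarrow> f z - a2 = (g2 z)\<^sup>2"
      and f3: "\<And>z. z \<in> ball 0 1 \<Longrightarrow> f z - a3 = (g3 z)\<^sup>2"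
      and fin: "finite {z\<in>ball 0 1. f z = a3}"
      and a: "a1 \<noteq> a2" "a1 \<noteq> a3" "norm (a3 - a2) \<ge> 1"
      and M: "norm a1 \<le> M" "norm a2 \<le> M" "norm a3 \<le> M" "norm (f 0) \<le> M"
      and z: "norm z \<le> 1 / 4"
    define h where "h u = g1 u + g2 u" for u
    define s t where "s = csqrt (a3 - a1)" and "t = csqrt (a3 - a2)"
    define p q where "p = s + t" and "q = s - t"
    have s2: "s\<^sup>2 = a3 - a1" and t2: "t\<^sup>2 = a3 - a2"
      by (simp_all add: s_def t_def)
    have sum: "p + q = 2 * s" and diff: "p - q = 2 * t" and prod: "p * q = a2 - a1"
      using s2 t2 by (simp_all add: p_def q_def algebra_simps power2_eq_square)
    have st: "s \<noteq> 0" "t \<noteq> 0"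
      using a by (auto simp: s_def t_def)
    \<comment> \<open>These inequalities make \<open>p\<close>, \<open>q\<close>,
      \<open>- p\<close>, \<open>- q\<close> pairwise distinct, so the four factors of the product
      below have no common zeros.\<close>
    have nz: "p \<noteq> 0" "q \<noteq> 0" "p \<noteq> q" "p + q \<noteq> 0"
      using sum diff prod st a(1) by auto
    have "norm s \<le> sqrt (2 * M)" "norm t \<le> sqrt (2 * M)"
      using norm_triangle_ineq4[of a3 a1] norm_triangle_ineq4[of a3 a2] M
      by (auto intro!: norm_le_sqrt simp: s2 t2)
    then have pqN: "norm p \<le> N" "norm q \<le> N"
      unfolding p_def q_def N_def using norm_triangle_ineq[of s t] norm_triangle_ineq4[of s t]
      by simp_all
    have "1 \<le> norm (t\<^sup>2)"
      using a(3) by (simp add: t2)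
    then have "1\<^sup>2 \<le> (norm t)\<^sup>2"
      by (simp add: norm_power)
    then have "1 \<le> norm t"
      by (rule power2_le_imp_le) simp
    then have pq1: "norm (p - q) \<ge> 1"
      by (simp add: diff norm_mult)
    have "norm (g1 0) \<le> sqrt (2 * M)" "norm (g2 0) \<le> sqrt (2 * M)"
      using norm_triangle_ineq4[of "f 0" a1] norm_triangle_ineq4[of "f 0" a2] M
      by (auto intro!: norm_le_sqrt simp: f1[symmetric] f2[symmetric])
    then have h0: "norm (h 0) \<le> N"
      unfolding h_def N_def using norm_triangle_ineq[of "g1 0" "g2 0"] by simp
    have h_hol: "h holomorphic_on ball 0 1"
      unfolding h_def by (intro holomorphic_intros g)
    have h_prod: "h u * (g1 u - g2 u) = p * q" if "u \<in> ball 0 1" for u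
      using f1[OF that] f2[OF that] prod unfolding h_def by algebra
    have h_nz: "h u \<noteq> 0" if "u \<in> ball 0 1" for u
      using h_prod[OF that] nz by auto
    have factor: "(h u - p) * (h u - q) * ((h u + p) * (h u + q)) = (2 * h u * g3 u)\<^sup>2"
      if u: "u \<in> ball 0 1" for u
    proof -
      \<comment> \<open>A Joukowski-type relation: \<open>g1\<close> is half of
        \<open>h + p * q / h\<close>. Thus \<open>g1 = s\<close> exactly where \<open>h\<close> is
        \<open>p\<close> or \<open>q\<close>, and \<open>g1 = - s\<close> exactly where
        \<open>h\<close> is \<open>- p\<close> or \<open>- q\<close>.\<close>
      have "2 * h u * g1 u = (h u)\<^sup>2 + p * q"
        using h_prod[OF u] unfolding h_def by algebra
      then have "(h u - p) * (h u - q) = 2 * h u * (g1 u - s)"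
          "(h u + p) * (h u + q) = 2 * h u * (g1 u + s)"
        using sum by algebra+
      then have "(h u - p) * (h u - q) * ((h u + p) * (h u + q)) = (2 * h u)\<^sup>2 * ((g1 u)\<^sup>2 - s\<^sup>2)"
        by algebra
      also have "(g1 u)\<^sup>2 - s\<^sup>2 = (g3 u)\<^sup>2"
        using f1[OF u] f3[OF u] s2 by algebra
      finally show ?thesis
        by (simp add: power_mult_distrib)
    qed
    have ball: "open (ball (0 :: complex) 1)" "contractible (ball (0 :: complex) 1)"
      by (simp_all add: convex_imp_contractible)
    have root_hol: "(\<lambda>u. 2 * h u * g3 u) holomorphic_on ball 0 1"
      by (intro holomorphic_intros h_hol g)
    \<comment> \<open>This transfers the finiteness of the fibre of \<open>f\<close> over
      \<open>a3\<close> to the zeros of \<open>h - p\<close> and \<open>h - q\<close>.\<close>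
    have g3_zero: "f u = a3" if "u \<in> ball 0 1" "h u = p \<or> h u = q" for u
      using factor[OF that(1)] h_nz[OF that(1)] f3[OF that(1)] that(2) by auto
    obtain k where k: "k holomorphic_on ball 0 1" "\<And>u. u \<in> ball 0 1 \<Longrightarrow> h u - p = (k u)\<^sup>2"
    proof (rule coprime_factor_of_square[OF _ _ root_hol ball])
      show "(\<lambda>u. h u - p) holomorphic_on ball 0 1"
        "(\<lambda>u. (h u - q) * ((h u + p) * (h u + q))) holomorphic_on ball 0 1"
        by (intro holomorphic_intros h_hol)+
      show "finite {u \<in> ball 0 1. h u - p = 0}"
        by (rule finite_subset[OF _ fin]) (use g3_zero in auto)
      show "(h u - p) * ((h u - q) * ((h u + p) * (h u + q))) = (2 * h u * g3 u)\<^sup>2"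
        if "u \<in> ball 0 1" for u
        using factor[OF that] by (simp only: mult.assoc)
      show "(h u - q) * ((h u + p) * (h u + q)) \<noteq> 0" if "h u - p = 0" for u
        using that nz by auto
    qed blast
    obtain l where l: "l holomorphic_on ball 0 1" "\<And>u. u \<in> ball 0 1 \<Longrightarrow> h u - q = (l u)\<^sup>2"
    proof (rule coprime_factor_of_square[OF _ _ root_hol ball])
      show "(\<lambda>u. h u - q) holomorphic_on ball 0 1"
        "(\<lambda>u. (h u - p) * ((h u + p) * (h u + q))) holomorphic_on ball 0 1"
        by (intro holomorphic_intros h_hol)+
      show "finite {u \<in> ball 0 1. h u - q = 0}"
        by (rule finite_subset[OF _ fin]) (use g3_zero in auto)
      show "(h u - q) * ((h u - p) * ((h u + p) * (h u + q))) = (2 * h u * g3 u)\<^sup>2"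
        if "u \<in> ball 0 1" for u
        unfolding factor[OF that, symmetric] by (simp only: mult_ac)
      show "(h u - p) * ((h u + p) * (h u + q)) \<noteq> 0" if "h u - q = 0" for u
        using that nz by (auto simp: add.commute)
    qed blast
    have "norm (h z) \<le> B"
      by (rule B[OF k(1) l(1) k(2) l(2) h_nz pqN pq1 h0 z])
    then show "norm (g1 z + g2 z) \<le> B"
      by (simp add: h_def)
  qed
qed

text \<open>Replacing \<open>g2\<close> by \<open>- g2\<close> bounds \<open>g1 - g2\<close> as
  well, hence \<open>g1\<close> and then \<open>f\<close> on the disk of radius 1/4. Cauchy's
  inequality on that disk contributes the factor 4.\<close>

lemma three_even_values_deriv_bound:
  fixes M :: real
  obtains B where "\<And>f g1 g2 g3 a1 a2 a3. \<lbrakk>f holomorphic_on ball 0 1; g1 holomorphic_on ball 0 1;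
      g2 holomorphic_on ball 0 1; g3 holomorphic_on ball 0 1;
      \<And>z. z \<in> ball 0 1 \<Longrightarrow> f z - a1 = (g1 z)\<^sup>2; \<And>z. z \<in> ball 0 1 \<Longrightarrow> f z - a2 = (g2 z)\<^sup>2;
      \<And>z. z \<in> ball 0 1 \<Longrightarrow> f z - a3 = (g3 z)\<^sup>2; finite {z\<in>ball 0 1. f z = a3};
      a1 \<noteq> a2; a1 \<noteq> a3; norm (a3 - a2) \<ge> 1;
      norm a1 \<le> M; norm a2 \<le> M; norm a3 \<le> M; norm (f 0) \<le> M\<rbrakk>
      \<Longrightarrow> norm (deriv f 0) \<le> B"
proof -
  obtain B where B: "\<And>f g1 g2 g3 a1 a2 a3 z. \<lbrakk>g1 holomorphic_on ball 0 1;
      g2 holomorphic_on ball 0 1; g3 holomorphic_on ball 0 1;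
      \<And>z. z \<in> ball 0 1 \<Longrightarrow> f z - a1 = (g1 z)\<^sup>2; \<And>z. z \<in> ball 0 1 \<Longrightarrow> f z - a2 = (g2 z)\<^sup>2;
      \<And>z. z \<in> ball 0 1 \<Longrightarrow> f z - a3 = (g3 z)\<^sup>2; finite {z\<in>ball 0 1. f z = a3};
      a1 \<noteq> a2; a1 \<noteq> a3; norm (a3 - a2) \<ge> 1;
      norm a1 \<le> M; norm a2 \<le> M; norm a3 \<le> M; norm (f 0) \<le> M; norm z \<le> 1 / 4\<rbrakk>
      \<Longrightarrow> norm (g1 z + g2 z) \<le> B"
    using three_even_values_sum_bound[of M] by blast
  show thesis
  proof (rule that[of "4 * (B\<^sup>2 + M)"])
    fix f g1 g2 g3 :: "complex \<Rightarrow> complex" and a1 a2 a3 :: complex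
    assume f: "f holomorphic_on ball 0 1"
      and g: "g1 holomorphic_on ball 0 1" "g2 holomorphic_on ball 0 1" "g3 holomorphic_on ball 0 1"
      and f1: "\<And>z. z \<in> ball 0 1 \<Longrightarrow> f z - a1 = (g1 z)\<^sup>2"
      and f2: "\<And>z. z \<in> ball 0 1 \<Longrightarrow> f z - a2 = (g2 z)\<^sup>2"
      and f3: "\<And>z. z \<in> ball 0 1 \<Longrightarrow> f z - a3 = (g3 z)\<^sup>2"
      and fin: "finite {z\<in>ball 0 1. f z = a3}"
      and a: "a1 \<noteq> a2" "a1 \<noteq> a3" "norm (a3 - a2) \<ge> 1"
      and M: "norm a1 \<le> M" "norm a2 \<le> M" "norm a3 \<le> M" "norm (f 0) \<le> M"
    have bound: "norm (f z) \<le> B\<^sup>2 + M" if z: "norm z \<le> 1 / 4" for z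
    proof -
      have "norm (g1 z + g2 z) \<le> B"
        by (rule B[OF g f1 f2 f3 fin a M z])
      moreover have "norm (g1 z + - g2 z) \<le> B"
        by (rule B[OF g(1) holomorphic_on_minus[OF g(2)] g(3) f1 _ f3 fin a M z]) (use f2 in auto)
      ultimately have "norm (2 * g1 z) \<le> 2 * B"
        using norm_triangle_ineq[of "g1 z + g2 z" "g1 z + - g2 z"] by simp
      then have "norm (g1 z) \<le> B"
        by (simp add: norm_mult)
      then have "norm ((g1 z)\<^sup>2) \<le> B\<^sup>2"
        by (simp add: norm_power power_mono)
      moreover have "f z = (g1 z)\<^sup>2 + a1"
        using f1[of z] z by (simp add: algebra_simps)
      ultimately show ?thesis
        using norm_triangle_ineq[of "(g1 z)\<^sup>2" a1] M(1) by simp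
    qed
    have sub: "cball 0 (1 / 4) \<subseteq> ball (0 :: complex) 1"
      by auto
    have "norm ((deriv ^^ 1) f 0) \<le> fact 1 * (B\<^sup>2 + M) / (1 / 4) ^ 1"
    proof (rule Cauchy_inequality)
      show "f holomorphic_on ball 0 (1 / 4)"
        using f by (rule holomorphic_on_subset) auto
      show "continuous_on (cball 0 (1 / 4)) f"
        using holomorphic_on_imp_continuous_on[OF holomorphic_on_subset[OF f sub]] .
    qed (use bound in auto)
    then show "norm (deriv f 0) \<le> 4 * (B\<^sup>2 + M)"
      by simp
  qed
qed

section \<open>Surjectivity of branched coverings of the plane\<close>

text \<open>A neighbourhood \<open>U\<close> from the definition lies in the image as soon as it
  meets it, since every component over \<open>U\<close> maps onto \<open>U\<close>. The image is
  therefore open and closed in the connected plane.\<close>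

lemma branched_covering_surj:
  assumes "branched_covering S' UNIV f" "S' \<noteq> {}"
  shows "f ` S' = UNIV"
proof -
  have local: "\<exists>U. open U \<and> w \<in> U \<and> (U \<subseteq> f ` S' \<or> U \<inter> f ` S' = {})" for w
  proof -
    obtain U where U: "open U" "w \<in> U"
        "\<And>C. C \<in> components {z\<in>S'. f z \<in> U} \<Longrightarrow> f ` C = U"
      using assms(1)[unfolded branched_covering_def, THEN conjunct2, THEN conjunct2,
          rule_format, OF UNIV_I, of w]
      by meson
    have "U \<subseteq> f ` S'" if "z \<in> S'" "f z \<in> U" for z
    proof -
      have "z \<in> \<Union> (components {z\<in>S'. f z \<in> U})"
        using that Union_components[of "{z\<in>S'. f z \<in> U}"] by blast
      then obtain C where C: "C \<in> components {z\<in>S'. f z \<in> U}"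
        by blast
      have "C \<subseteq> S'"
        using in_components_subset[OF C] by blast
      then show ?thesis
        using U(3)[OF C] by blast
    qed
    then show ?thesis
      using U by blast
  qed
  have "open (f ` S')"
  proof (subst open_subopen, intro ballI)
    fix w assume "w \<in> f ` S'"
    then show "\<exists>U. open U \<and> w \<in> U \<and> U \<subseteq> f ` S'"
      using local[of w] by blast
  qed
  moreover have "open (- (f ` S'))"
  proof (subst open_subopen, intro ballI)
    fix w assume "w \<in> - (f ` S')"
    then show "\<exists>U. open U \<and> w \<in> U \<and> U \<subseteq> - (f ` S')"
      using local[of w] by blast
  qed
  ultimately show ?thesis
    using clopen[of "f ` S'"] assms(2) by (simp add: closed_def)
qed

theorem theorem1p5:
  fixes K :: real and z :: "nat \<Rightarrow> complex"
    and \<nu> :: "complex \<Rightarrow> nat" and \<rho> :: "complex \<Rightarrow> ereal"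
  assumes "K > 1"
    and "filterlim (\<lambda>j. norm (z j)) at_top sequentially"
    and "\<And>j. norm (z j) < norm (z (Suc j))"
    and "\<And>j. norm (z (Suc j)) \<le> K * norm (z j)"
    and "\<nu> = (\<lambda>w. if w \<in> range z then 2 else 1)"
    and "hyperbolic_orbifold UNIV \<nu>"
    and "hyperbolic_density UNIV \<nu> \<rho>"
  shows "\<exists>c>0. \<exists>R>0. \<forall>w. norm w \<ge> R \<longrightarrow> \<rho> w \<ge> ereal (c / norm w)"
proof -
  obtain \<pi> where cov: "disk_covering UNIV \<nu> \<pi>"
    and dens: "\<And>\<zeta>. \<zeta> \<in> ball 0 1 \<Longrightarrow> \<nu> (\<pi> \<zeta>) = 1 \<Longrightarrow>
      \<rho> (\<pi> \<zeta>) * ereal (norm (deriv \<pi> \<zeta>)) = ereal (disk_density \<zeta>)"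
    and dens_ram: "\<And>w. \<nu> w > 1 \<Longrightarrow> \<rho> w = \<infinity>"
    using assms(7) unfolding hyperbolic_density_def by auto
  have hol: "\<pi> holomorphic_on ball 0 1"
    and bc: "branched_covering (ball 0 1) UNIV \<pi>"
    and degree: "\<And>\<zeta>. \<zeta> \<in> ball 0 1 \<Longrightarrow> \<nu> (\<pi> \<zeta>) = local_degree \<pi> \<zeta>"
    using cov by (auto simp: orbifold_covering_def branched_covering_def)
  have surj: "\<pi> ` ball 0 1 = UNIV"
    using bc by (rule branched_covering_surj) auto
  have nonconst: "\<not> (\<lambda>\<zeta>. \<pi> \<zeta> - a) constant_on ball 0 1" for a
  proof
    assume "(\<lambda>\<zeta>. \<pi> \<zeta> - a) constant_on ball 0 1"
    then obtain c where "\<And>\<zeta>. \<zeta> \<in> ball 0 1 \<Longrightarrow> \<pi> \<zeta> - a = c"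
      unfolding constant_on_def by blast
    then have "\<pi> ` ball 0 1 \<subseteq> {a + c}"
      by (auto simp: algebra_simps)
    with surj have "(0 :: complex) = 1"
      by (metis UNIV_I singletonD subsetD)
    then show False by simp
  qed
  obtain B0 where B0: "\<And>f g1 g2 g3 a1 a2 a3. \<lbrakk>f holomorphic_on ball 0 1;
      g1 holomorphic_on ball 0 1; g2 holomorphic_on ball 0 1; g3 holomorphic_on ball 0 1;
      \<And>z. z \<in> ball 0 1 \<Longrightarrow> f z - a1 = (g1 z)\<^sup>2; \<And>z. z \<in> ball 0 1 \<Longrightarrow> f z - a2 = (g2 z)\<^sup>2;
      \<And>z. z \<in> ball 0 1 \<Longrightarrow> f z - a3 = (g3 z)\<^sup>2; finite {z\<in>ball 0 1. f z = a3};
      a1 \<noteq> a2; a1 \<noteq> a3; norm (a3 - a2) \<ge> 1;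
      norm a1 \<le> 2 * K; norm a2 \<le> 2 * K; norm a3 \<le> 2 * K; norm (f 0) \<le> 2 * K\<rbrakk>
      \<Longrightarrow> norm (deriv f 0) \<le> B0"
    using three_even_values_deriv_bound[of "2 * K"] by blast
  \<comment> \<open>The maximum with 1 makes \<open>B\<close> positive, so that it can serve as a
    denominator.\<close>
  define B where "B = max B0 1"
  have "B > 0" by (simp add: B_def)
  have mono: "norm (z i) < norm (z j)" if "i < j" for i j
    using assms(3) that by (rule lift_Suc_mono_less)
  have z1: "norm (z 1) > 0"
    using mono[of 0 1] norm_ge_zero[of "z 0"] by linarith

  \<comment> \<open>Derivative bound for the covering\<close>
  have main: "norm (deriv \<pi> \<zeta>) * ((1 - norm \<zeta>) / 2) \<le> B * norm (\<pi> \<zeta>)"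
    if \<zeta>: "\<zeta> \<in> ball 0 1" and w: "norm (\<pi> \<zeta>) \<ge> norm (z 1)" for \<zeta>
  proof -
    define w where "w = \<pi> \<zeta>"
    \<comment> \<open>Half the distance to the unit circle: the closed disk is compact in the unit
      disk, so the nonconstant \<pi> has finite fibres on it.\<close>
    define r where "r = (1 - norm \<zeta>) / 2"
    have r: "r > 0" using \<zeta> by (simp add: r_def)
    have w_ge: "norm w \<ge> norm (z 1)" and w_pos: "norm w > 0" and w0: "w \<noteq> 0"
      using w z1 by (auto simp: w_def)
    have sub: "cball \<zeta> r \<subseteq> ball 0 1"
    proof
      fix u assume "u \<in> cball \<zeta> r"
      then have "norm (u - \<zeta>) \<le> r"
        by (simp add: dist_norm norm_minus_commute)
      with \<zeta> norm_triangle_ineq[of "u - \<zeta>" \<zeta>] show "u \<in> ball 0 1"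
        by (simp add: r_def field_simps)
    qed
    have fin: "finite {u\<in>ball \<zeta> r. \<pi> u - a = 0}" for a
    proof (rule finite_subset)
      show "finite {u\<in>cball \<zeta> r. \<pi> u - a = 0}"
        by (rule holomorphic_compact_finite_zeros[OF _ _ _ _ sub nonconst])
          (auto intro!: holomorphic_intros hol)
    qed auto
    define T where "T u = \<zeta> + of_real r * u" for u
    define f where "f u = \<pi> (T u) / w" for u
    have T: "T u \<in> ball \<zeta> r" if "u \<in> ball 0 1" for u
      using that r by (simp add: T_def dist_norm norm_mult)
    have T_hol: "T holomorphic_on A" for A
      unfolding T_def by (intro holomorphic_intros)
    have pull: "(\<lambda>u. g (T u)) holomorphic_on ball 0 1" if "g holomorphic_on ball \<zeta> r" for g
      using holomorphic_on_compose_gen[OF T_hol that, of "ball 0 1"] T by (force simp: comp_def)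
    have hol_r: "\<pi> holomorphic_on ball \<zeta> r"
      using hol by (rule holomorphic_on_subset) (use sub in auto)
    have f_hol: "f holomorphic_on ball 0 1"
      unfolding f_def using w0 by (intro holomorphic_intros pull hol_r)
    have root: "\<exists>g. g holomorphic_on ball 0 1 \<and> (\<forall>u\<in>ball 0 1. f u - z j / w = (g u)\<^sup>2)" for j
    proof -
      obtain g where g: "g holomorphic_on ball \<zeta> r" "\<And>u. u \<in> ball \<zeta> r \<Longrightarrow> \<pi> u - z j = (g u)\<^sup>2"
      proof (rule even_zeros_imp_square)
        show "(\<lambda>u. \<pi> u - z j) holomorphic_on ball \<zeta> r"
          by (intro holomorphic_intros hol_r)
        show "finite {u\<in>ball \<zeta> r. \<pi> u - z j = 0}"
          by (rule fin)
        fix u assume u: "u \<in> ball \<zeta> r" "\<pi> u - z j = 0"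
        then have "u \<in> ball 0 1" "\<pi> u = z j"
          using subsetD[OF sub, of u] by auto
        \<comment> \<open>Ramification value 2 downstairs and 1 upstairs force local degree 2 at
          every preimage of \<open>z j\<close>.\<close>
        then have "nat (zorder (\<lambda>v. \<pi> v - z j) u) = 2"
          using degree[of u] by (simp add: local_degree_def assms(5))
        then have "zorder (\<lambda>v. \<pi> v - z j) u = 2"
          by linarith
        then show "even (zorder (\<lambda>v. \<pi> v - z j) u)"
          by simp
      qed (auto simp: convex_imp_contractible)
      \<comment> \<open>The divisor \<open>csqrt w\<close> accounts for the division of \<pi> by
        \<open>w\<close> in \<open>f\<close>.\<close>
      have "(\<lambda>u. g (T u) / csqrt w) holomorphic_on ball 0 1"
        using w0 by (intro holomorphic_intros pull g) auto
      moreover have "f u - z j / w = (g (T u) / csqrt w)\<^sup>2" if "u \<in> ball 0 1" for u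
        using g(2)[OF T[OF that]] by (simp add: f_def power_divide diff_divide_distrib[symmetric])
      ultimately show ?thesis by blast
    qed
    obtain g1 g2 where g1: "g1 holomorphic_on ball 0 1" "\<And>u. u \<in> ball 0 1 \<Longrightarrow> f u - z 1 / w = (g1 u)\<^sup>2"
      and g2: "g2 holomorphic_on ball 0 1" "\<And>u. u \<in> ball 0 1 \<Longrightarrow> f u - z 0 / w = (g2 u)\<^sup>2"
      using root by metis
    \<comment> \<open>Exceeding 2 |w| keeps \<open>z l\<close> at distance at least |w| from
      \<open>z 0\<close>; minimality and the growth condition give |z l| \<le> 2 K |w|.\<close>
    define l where "l = (LEAST j. norm (z j) > 2 * norm w)"
    have "\<exists>j. norm (z j) > 2 * norm w"
      using assms(2) by (auto simp: filterlim_at_top_dense dest!: spec[of _ "2 * norm w"]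
          dest: eventually_happens)
    then have l: "norm (z l) > 2 * norm w"
      unfolding l_def by (rule LeastI_ex)
    \<comment> \<open>This makes \<open>z l\<close> distinct from \<open>z 1\<close> and gives
      \<open>l\<close> a predecessor to which minimality applies.\<close>
    have "1 < l"
    proof (rule ccontr)
      assume "\<not> 1 < l"
      then have "l = 0 \<or> l = 1" by auto
      then have "norm (z l) \<le> norm (z 1)" using mono[of 0 1] by auto
      with l w_ge w_pos show False by linarith
    qed
    then obtain i where i: "l = Suc i" using not0_implies_Suc by (metis not_less0)
    then have "norm (z i) \<le> 2 * norm w"
      using not_less_Least[of i "\<lambda>j. norm (z j) > 2 * norm w"] by (auto simp: l_def not_less)
    then have "K * norm (z i) \<le> K * (2 * norm w)"
      using assms(1) by (intro mult_left_mono) auto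
    then have zl: "norm (z l) \<le> 2 * K * norm w"
      using assms(4)[of i] i by simp
    obtain g3 where g3: "g3 holomorphic_on ball 0 1" "\<And>u. u \<in> ball 0 1 \<Longrightarrow> f u - z l / w = (g3 u)\<^sup>2"
      using root by metis
    have z0: "norm (z 0) \<le> norm w"
      using mono[of 0 1] w_ge by simp
    have "norm w \<le> 2 * K * norm w"
      using assms(1) w_pos by simp
    then have small: "norm (z j / w) \<le> 2 * K" if "norm (z j) \<le> norm w" for j
      using that w_pos order_trans[OF that] by (simp add: norm_divide divide_le_eq)
    have bound: "norm (deriv f 0) \<le> B0"
    proof (rule B0[OF f_hol g1(1) g2(1) g3(1) g1(2) g2(2) g3(2)])
      have "{u\<in>ball 0 1. f u = z l / w} \<subseteq> T -` {u\<in>ball \<zeta> r. \<pi> u - z l = 0}"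
        using T w0 by (auto simp: f_def)
      moreover have "inj T"
        using r by (auto simp: inj_def T_def)
      ultimately show "finite {u\<in>ball 0 1. f u = z l / w}"
        using finite_vimageI[OF fin] finite_subset by blast
      show "z 1 / w \<noteq> z 0 / w" "z 1 / w \<noteq> z l / w"
        using mono[of 0 1] mono[OF \<open>1 < l\<close>] w0 by auto
      have "norm w \<le> norm (z l - z 0)"
        using l z0 norm_triangle_ineq2[of "z l" "z 0"] by linarith
      then show "1 \<le> norm (z l / w - z 0 / w)"
        using w_pos by (simp add: diff_divide_distrib[symmetric] norm_divide le_divide_eq)
      show "norm (z l / w) \<le> 2 * K"
        using zl w_pos by (simp add: norm_divide divide_le_eq)
      show "norm (f 0) \<le> 2 * K"
        using assms(1) w0 by (simp add: f_def T_def w_def)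
    qed (use small z0 w_ge in auto)
    have "(\<pi> has_field_derivative deriv \<pi> \<zeta>) (at (T 0))"
      using holomorphic_derivI[OF hol open_ball \<zeta>] by (simp add: T_def)
    moreover have "(T has_field_derivative of_real r) (at 0)"
      unfolding T_def by (auto intro!: derivative_eq_intros)
    ultimately have "((\<lambda>u. \<pi> (T u)) has_field_derivative deriv \<pi> \<zeta> * of_real r) (at 0)"
      by (rule DERIV_chain2)
    then have "(f has_field_derivative deriv \<pi> \<zeta> * of_real r / w) (at 0)"
      unfolding f_def by (rule DERIV_cdivide)
    then have "deriv f 0 = deriv \<pi> \<zeta> * of_real r / w"
      by (rule DERIV_imp_deriv)
    then have "norm (deriv \<pi> \<zeta>) * r / norm w \<le> B"
      using bound r by (simp add: norm_mult norm_divide B_def)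
    then show ?thesis
      using w_pos by (simp add: divide_le_eq r_def w_def)
  qed

  \<comment> \<open>From the derivative bound to the density\<close>
  have "\<rho> w \<ge> ereal (1 / (2 * B) / norm w)" if w: "norm w \<ge> norm (z 1)" for w
  proof (cases "\<rho> w = \<infinity>")
    case False
    obtain \<zeta> where \<zeta>: "\<zeta> \<in> ball 0 1" "w = \<pi> \<zeta>"
      using surj by (metis UNIV_I imageE)
    define d where "d = norm (deriv \<pi> \<zeta>)"
    have n: "norm \<zeta> < 1" using \<zeta> by simp
    have "\<nu> w = 1"
      using False dens_ram[of w] by (auto simp: assms(5) split: if_splits)
    then have eq: "\<rho> w * ereal d = ereal (disk_density \<zeta>)"
      using dens \<zeta> by (simp add: d_def)
    have sq: "(norm \<zeta>)\<^sup>2 < 1"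
      using n by (simp add: abs_square_less_1)
    have dd: "disk_density \<zeta> > 0"
      using sq by (simp add: disk_density_def)
    \<comment> \<open>A zero derivative would make the product 0 whatever \<rho> is, against the
      positive disk density.\<close>
    have d_pos: "d > 0"
      using eq dd by (cases "d = 0") (auto simp: d_def zero_ereal_def[symmetric])
    obtain x where x: "\<rho> w = ereal x"
      using eq d_pos False by (cases "\<rho> w") auto
    have xd: "x * d = disk_density \<zeta>"
      using eq x by simp
    have w_pos: "norm w > 0" using w z1 by linarith
    have db: "d * ((1 - norm \<zeta>) / 2) \<le> B * norm w"
      using main[OF \<zeta>(1)] w \<zeta>(2) by (simp add: d_def)
    \<comment> \<open>The disk density is thus at least 1 / (1 - |\<zeta>|). The derivative bound
      gives d (1 - |\<zeta>|) \<le> 2 B |w|, whence the constant 1 / (2 B).\<close>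
    have "1 - (norm \<zeta>)\<^sup>2 = (1 - norm \<zeta>) * (1 + norm \<zeta>)"
      by (simp add: power2_eq_square algebra_simps)
    also have "\<dots> \<le> (1 - norm \<zeta>) * 2"
      using n by (intro mult_left_mono) auto
    finally have "disk_density \<zeta> \<ge> 2 / ((1 - norm \<zeta>) * 2)"
      unfolding disk_density_def using sq by (intro divide_left_mono) auto
    then have "1 \<le> x * d * (1 - norm \<zeta>)"
      using xd n by (simp add: divide_le_eq algebra_simps)
    also have "\<dots> = x * (d * (1 - norm \<zeta>))"
      by simp
    also have "\<dots> \<le> x * (2 * B * norm w)"
    proof (rule mult_left_mono)
      show "0 \<le> x"
        using xd dd d_pos by (metis less_eq_real_def zero_less_mult_pos2)
    qed (use db in simp)
    finally have "1 / (2 * B) / norm w \<le> x"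
      using \<open>B > 0\<close> w_pos by (simp add: divide_le_eq mult_ac)
    then show ?thesis
      by (simp add: x)
  qed auto
  then show ?thesis
    using \<open>B > 0\<close> z1 by (intro exI[of _ "1 / (2 * B)"] exI[of _ "norm (z 1)"] conjI) auto
qed

end
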